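(* Let $u^{(1)},u^{(2)},\dots,u^{(l)},w$ be permutations such that $\mathrm{cc}(w)$ is a shuffle of $\mathrm{cc}(u^{(1)}),\dots,\mathrm{cc}(u^{(l)})$. Then $$\mathrm{ctype}(w)\ \unrhd\ \mathrm{ctype}(u^{(1)})+\mathrm{ctype}(u^{(2)})+\cdots+\mathrm{ctype}(u^{(l)}),$$ where the right-hand side is the partition given by the partwise sum of $\mathrm{ctype}(u^{(1)}),\dots,\mathrm{ctype}(u^{(l)})$.
   Context: Partitions are drawn in French notation: row 1 is the bottom row. Dominance order: for partitions of the same size, $\mu\unrhd\lambda$ iff $\mu_1+\cdots+\mu_k\ge\lambda_1+\cdots+\lambda_k$ for all $k$. $P(w)$ denotes the Schensted (row) insertion tableau of a word $w$ with distinct letters. Cocharge word: for $w\in S_n$ (one-line notation), $\mathrm{cc}(w)$ is the word of length $n$ obtained by labelling the letters of $w$: the letter $1$ gets label $0$; if $i$ has label $k$, then $i+1$ gets label $k$ if it is to the right of $i$ in $w$, and label $k+1$ if it is to the left of $i$. Then $\mathrm{cc}(w)_j$ is the label of $w_j$. Shuffle: a word is a shuffle of words $z^{(1)},\dots,z^{(l)}$ if it is an interleaving of them, i.e. its positions can be partitioned into $l$ sets such that the subword on the $j$th set is $z^{(j)}$. Catabolizability type: for a standard tableau $T$, the reading word $\mathrm{rw}(T)$ is obtained by concatenating the rows, each read left to right, from the top row to the bottom row. Write $\mathrm{rw}(T)=vv'$ with $v'$ the first (bottom) row; catabolism is $K(T)=P(v'v)$. Let $d(T)$ be the largest $m$ such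 that the first row of $T$ contains $1,2,\dots,m$. Then $\mathrm{ctype}(T)=(d(T),\,d(K(T))-d(T),\,\dots,\,d(K^i(T))-d(K^{i-1}(T)),\dots)$ (trailing zeros dropped); it is a known fact that this is a partition of the size of $T$. For a permutation $w$, $\mathrm{ctype}(w):=\mathrm{ctype}(P(w))$. *)

theory Defs
  imports "HOL-Combinatorics.Multiset_Permutations"
begin

text \<open>A permutation in \<open>S\<^sub>n\<close> is given by its one-line notation, a list that is an enumeration of
  \<open>{1..n}\<close>; its size is the length of the list.\<close>

abbreviation is_perm :: "nat list \<Rightarrow> bool" where
  "is_perm w \<equiv> w \<in> permutations_of_set {1..length w}"

definition left_of :: "nat list \<Rightarrow> nat \<Rightarrow> nat \<Rightarrow> bool" where
  "left_of w x y \<longleftrightarrow> (\<exists>q<length w. \<exists>p<q. w ! p = x \<and> w ! q = y)"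

text \<open>The letters of a permutation start at \<open>1\<close>, so the value of \<open>cc_label w\<close> at \<open>0\<close> is never used.\<close>

fun cc_label :: "nat list \<Rightarrow> nat \<Rightarrow> nat" where
  "cc_label w 0 = 0"
| "cc_label w (Suc 0) = 0"
| "cc_label w (Suc (Suc i)) =
     (if left_of w (Suc i) (Suc (Suc i)) then cc_label w (Suc i) else cc_label w (Suc i) + 1)"

definition cc :: "nat list \<Rightarrow> nat list" where
  "cc w = map (cc_label w) w"

text \<open>The partition of the positions of \<open>w\<close> into \<open>length zs\<close> sets is given by the map \<open>c\<close> that sends
  each position to the index of its set.\<close>

definition is_shuffle :: "'a list \<Rightarrow> 'a list list \<Rightarrow> bool" where
  "is_shuffle w zs \<longleftrightarrow>
     (\<exists>c. (\<forall>p<length w. c p < length zs) \<and> (\<forall>j<length zs. nths w {p. c p = j} = zs ! j))"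

text \<open>A tableau is the list of its rows, starting with the first row, which is the bottom row in
  French notation. Inserting \<open>x\<close> into a row either appends it or replaces the leftmost entry that is
  larger than \<open>x\<close>; the second component of the result is the entry that is bumped, if any.\<close>

fun row_insert :: "nat \<Rightarrow> nat list \<Rightarrow> nat list \<times> nat option" where
  "row_insert x [] = ([x], None)"
| "row_insert x (y # ys) =
     (if x < y then (x # ys, Some y) else (let (zs, b) = row_insert x ys in (y # zs, b)))"

fun tableau_insert :: "nat \<Rightarrow> nat list list \<Rightarrow> nat list list" where
  "tableau_insert x [] = [[x]]"
| "tableau_insert x (r # rs) =
     (case row_insert x r of
        (r', None) \<Rightarrow> r' # rs
      | (r', Some y) \<Rightarrow> r' # tableau_insert y rs)"

definition insertion_tableau :: "nat list \<Rightarrow> nat list list" where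
  "insertion_tableau w = fold tableau_insert w []"

definition reading_word :: "nat list list \<Rightarrow> nat list" where
  "reading_word T = concat (rev T)"

definition first_row :: "nat list list \<Rightarrow> nat list" where
  "first_row T = (case T of [] \<Rightarrow> [] | r # rs \<Rightarrow> r)"

text \<open>For \<open>T = r # rs\<close> the reading word is \<open>reading_word rs @ r\<close>.\<close>

definition catabolism :: "nat list list \<Rightarrow> nat list list" where
  "catabolism T = insertion_tableau (first_row T @ reading_word (tl T))"

definition cat_depth :: "nat list list \<Rightarrow> nat" where
  "cat_depth T = (GREATEST m. {1..m} \<subseteq> set (first_row T))"

text \<open>A partition is the infinite sequence of its parts, padded with zeros and indexed from \<open>0\<close>.
  The truncating subtraction is harmless: on standard tableaux \<open>cat_depth\<close> does not decrease under
  \<open>catabolism\<close>, because the letters \<open>1, \<dots>, cat_depth T\<close> are inserted first, in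
  increasing order, and are never bumped.\<close>

definition ctype_tableau :: "nat list list \<Rightarrow> nat \<Rightarrow> nat" where
  "ctype_tableau T i =
     (case i of
        0 \<Rightarrow> cat_depth T
      | Suc k \<Rightarrow> cat_depth ((catabolism ^^ Suc k) T) - cat_depth ((catabolism ^^ k) T))"

definition ctype :: "nat list \<Rightarrow> nat \<Rightarrow> nat" where
  "ctype w = ctype_tableau (insertion_tableau w)"

text \<open>Intended for zero-padded partitions of the same size.\<close>

definition dominates :: "(nat \<Rightarrow> nat) \<Rightarrow> (nat \<Rightarrow> nat) \<Rightarrow> bool" (infix "\<unrhd>" 50) where
  "\<mu> \<unrhd> \<nu> \<longleftrightarrow> (\<forall>k. (\<Sum>i<k. \<nu> i) \<le> (\<Sum>i<k. \<mu> i))"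

end

theory Submission
  imports Defs
begin

text \<open>The partial sums of the catabolizability type have a description in the style of Greene's theorem,
  in terms of the labels \<open>cc_label w\<close> and the relative order of the letters only. Call a set \<open>C\<close> of letters
  of \<open>w\<close> a chain if for each label \<open>l > 0\<close> that occurs in \<open>C\<close>, some letter of \<open>C\<close> with label \<open>l\<close> is to the left of
  some letter of \<open>C\<close> with label \<open>l - 1\<close>. Then \<open>\<Sum>i<k. ctype w i\<close> is the largest \<open>m\<close> such that \<open>{1..m}\<close> can be
  partitioned into chains of size at most \<open>k\<close> (lemma \<open>le_sum_ctype_iff\<close>).

  With this description, a shuffle is easy to treat. If \<open>cc w\<close> is a shuffle of the words \<open>cc u\<close>, each \<open>u\<close>
  embeds into \<open>w\<close> with its labels and its relative order, so partitions into chains for the components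
  give one for a set of letters of \<open>w\<close> whose size is the sum of the sizes. This set need not be of the
  form \<open>{1..m}\<close>, but a missing small letter can always be exchanged for the greatest letter of some
  chain (\<open>packing_exchange\<close>).

  The description is proved by induction on \<open>k\<close>. Whether \<open>{1..m}\<close> can be partitioned into chains of size at
  most \<open>k\<close> is invariant under Knuth moves: if a move breaks the chains, two letters with the same label
  exchange their places in them (\<open>packable_knuth_invariant\<close>). So \<open>w\<close> may be replaced by the reading word \<open>v @ r\<close>
  of its insertion tableau, where \<open>r\<close> is the first row. Catabolism replaces \<open>v @ r\<close> by \<open>r @ v\<close>, and this
  lowers the labels of the letters in \<open>v\<close> by one and keeps those in \<open>r\<close>. Up to splitting off letters of
  label \<open>0\<close>, a chain for \<open>v @ r\<close> is then a letter of label \<open>0\<close> together with a chain for \<open>r @ v\<close>, so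
  chains of size at most \<open>k + 1\<close> for \<open>v @ r\<close> correspond to chains of size at most \<open>k\<close> for \<open>r @ v\<close>
  (\<open>packable_rotate_forward\<close>, \<open>packable_rotate_backward\<close>). That there are enough letters of label \<open>0\<close>
  for this is a consequence of the strict columns (\<open>card_label_one_above_first_row\<close>). For
  \<open>k = 1\<close> all letters up to \<open>m\<close> have label \<open>0\<close>, which means that they are in the first row.\<close>

section \<open>Relative order of letters and cocharge labels\<close>

lemma left_of_Nil [simp]: "\<not> left_of [] x y"
  by (simp add: left_of_def)

lemma left_of_Cons [simp]: "left_of (a # w) x y \<longleftrightarrow> (x = a \<and> y \<in> set w) \<or> left_of w x y"
proof
  assume "left_of (a # w) x y"
  then obtain p q where pq: "q < Suc (length w)" "p < q" "(a # w) ! p = x" "(a # w) ! q = y"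
    by (auto simp: left_of_def)
  then obtain q' where q': "q = Suc q'" by (cases q) auto
  show "(x = a \<and> y \<in> set w) \<or> left_of w x y"
    using pq q' by (cases p) (auto simp: left_of_def)
next
  assume "(x = a \<and> y \<in> set w) \<or> left_of w x y"
  then show "left_of (a # w) x y"
  proof
    assume "x = a \<and> y \<in> set w"
    then obtain q where "q < length w" "w ! q = y" "x = a" by (auto simp: in_set_conv_nth)
    then show ?thesis unfolding left_of_def
      by (intro exI[of _ "Suc q"] conjI exI[of _ 0]) auto
  next
    assume "left_of w x y"
    then obtain p q where "q < length w" "p < q" "w ! p = x" "w ! q = y" by (auto simp: left_of_def)
    then show ?thesis unfolding left_of_def
      by (intro exI[of _ "Suc q"] conjI exI[of _ "Suc p"]) auto
  qed
qed

lemma left_of_append [simp]: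
  "left_of (v @ w) x y \<longleftrightarrow> left_of v x y \<or> left_of w x y \<or> (x \<in> set v \<and> y \<in> set w)"
  by (induction v) auto

lemma left_of_in_set: "left_of w x y \<Longrightarrow> x \<in> set w \<and> y \<in> set w"
  by (induction w) auto

lemma left_of_asym: "distinct w \<Longrightarrow> left_of w x y \<Longrightarrow> \<not> left_of w y x"
  by (induction w) (auto dest: left_of_in_set)

lemma left_of_total: "x \<in> set w \<Longrightarrow> y \<in> set w \<Longrightarrow> x \<noteq> y \<Longrightarrow> left_of w x y \<or> left_of w y x"
  by (induction w) auto

lemma left_of_trans: "distinct w \<Longrightarrow> left_of w x y \<Longrightarrow> left_of w y z \<Longrightarrow> left_of w x z"
  by (induction w) (auto dest: left_of_in_set)

lemma left_of_sorted: "sorted_wrt (<) r \<Longrightarrow> left_of r x y \<longleftrightarrow> x \<in> set r \<and> y \<in> set r \<and> x < y"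
  by (induction r) (auto dest: left_of_in_set)

lemma cc_label_Suc:
  "0 < i \<Longrightarrow> cc_label w (Suc i) = (if left_of w i (Suc i) then cc_label w i else Suc (cc_label w i))"
  by (cases i) auto

lemma cc_label_mono: "i \<le> j \<Longrightarrow> cc_label w i \<le> cc_label w j"
proof (induction j rule: dec_induct)
  case (step j)
  have "cc_label w j \<le> cc_label w (Suc j)" by (cases j) auto
  with step show ?case by simp
qed simp

text \<open>If \<open>i\<close> and \<open>j\<close> have equal labels, then each letter from \<open>i + 1\<close> to \<open>j\<close> is to the right of its
  predecessor.\<close>

lemma left_of_if_same_label:
  assumes w: "distinct w" and i: "0 < i" and "i < j" "cc_label w i = cc_label w j"
  shows "left_of w i j"
  using assms(3,4)
proof (induction j)
  case (Suc j)
  have ij: "i \<le> j" "0 < j" using Suc.prems i by auto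
  have eq: "cc_label w i = cc_label w j" and adj: "left_of w j (Suc j)"
    using cc_label_mono[OF ij(1), of w] Suc.prems cc_label_Suc[OF ij(2), of w]
    by (auto split: if_splits)
  show ?case
    using Suc.IH eq adj ij(1) left_of_trans[OF w] by (cases "i = j") auto
qed simp

section \<open>Packings by chains\<close>

text \<open>The condition on \<open>j\<close> only concerns the label of \<open>j\<close>: consecutive labels are linked by a single pair of letters, and the other
  letters with these labels are free. This makes chains easy to modify.\<close>

definition chain :: "nat list \<Rightarrow> nat set \<Rightarrow> bool" where
  "chain w C \<longleftrightarrow> (\<forall>j\<in>C. 0 < cc_label w j \<longrightarrow>
     (\<exists>t\<in>C. \<exists>s\<in>C. cc_label w t = cc_label w j \<and> Suc (cc_label w s) = cc_label w j
        \<and> left_of w t s))"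

text \<open>Empty classes are allowed, so that removing letters from the classes of a packing leaves a
  packing.\<close>

definition packing :: "nat \<Rightarrow> nat list \<Rightarrow> nat set \<Rightarrow> nat set set \<Rightarrow> bool" where
  "packing k w U P \<longleftrightarrow> \<Union>P = U \<and> disjoint P \<and> (\<forall>C\<in>P. card C \<le> k \<and> chain w C)"

definition packable :: "nat \<Rightarrow> nat list \<Rightarrow> nat \<Rightarrow> bool" where
  "packable k w m \<longleftrightarrow> {1..m} \<subseteq> set w \<and> (\<exists>P. packing k w {1..m} P)"

lemma chainE:
  assumes "chain w C" "j \<in> C" "0 < cc_label w j"
  obtains t s where "t \<in> C" "s \<in> C" "cc_label w t = cc_label w j"
    "Suc (cc_label w s) = cc_label w j" "left_of w t s"
  using assms unfolding chain_def by blast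

lemma packable_mono: "packable k w m \<Longrightarrow> k \<le> l \<Longrightarrow> packable l w m"
  unfolding packable_def packing_def by (meson le_trans)

lemma chain_has_all_smaller_labels:
  assumes "chain w C" "j \<in> C" "l \<le> cc_label w j"
  shows "\<exists>s\<in>C. cc_label w s = l"
  using assms(3)
proof (induction l rule: inc_induct)
  case base
  show ?case using assms(2) by blast
next
  case (step l)
  then obtain s where s: "s \<in> C" "cc_label w s = Suc l" by blast
  obtain t where "t \<in> C" "Suc (cc_label w t) = cc_label w s"
    using chainE[OF assms(1) s(1)] s(2) by (metis zero_less_Suc)
  with s show ?case by auto
qed

text \<open>The condition on the label of \<open>i\<close> is already witnessed in \<open>C\<close>, since all labels up to that of \<open>t\<close>
  occur there.\<close>

lemma chain_insert_below:
  assumes C: "chain w C" "t \<in> C" "i \<le> t"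
  shows "chain w (insert i C)"
  unfolding chain_def
proof (intro ballI impI)
  fix j assume j: "j \<in> insert i C" "0 < cc_label w j"
  obtain j' where j': "j' \<in> C" "cc_label w j' = cc_label w j"
  proof (cases "j = i")
    case True
    then show ?thesis
      using chain_has_all_smaller_labels[OF C(1,2) cc_label_mono[OF C(3)]] that by blast
  qed (use j that in auto)
  from chainE[OF C(1) j'(1)] j'(2) j(2)
  show "\<exists>t\<in>insert i C. \<exists>s\<in>insert i C. cc_label w t = cc_label w j
      \<and> Suc (cc_label w s) = cc_label w j \<and> left_of w t s"
    by (metis insertI2)
qed

text \<open>The greatest letter \<open>z\<close> has the greatest label, so it can only serve as the left letter of a
  witnessing pair. Any other letter with the same label is to the left of \<open>z\<close> and can replace it.\<close>

lemma chain_remove_greatest: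
  assumes w: "distinct w" and C: "chain w C" "\<And>j. j \<in> C \<Longrightarrow> 0 < j \<and> j \<le> z"
  shows "chain w (C - {z})"
  unfolding chain_def
proof (intro ballI impI)
  fix j assume j: "j \<in> C - {z}" "0 < cc_label w j"
  obtain t s where ts: "t \<in> C" "s \<in> C" "cc_label w t = cc_label w j"
      "Suc (cc_label w s) = cc_label w j" "left_of w t s"
    using chainE[OF C(1)] j by blast
  have "cc_label w j \<le> cc_label w z" using cc_label_mono C(2) j(1) by blast
  then have s: "s \<in> C - {z}" using ts by auto
  show "\<exists>t\<in>C - {z}. \<exists>s\<in>C - {z}. cc_label w t = cc_label w j
      \<and> Suc (cc_label w s) = cc_label w j \<and> left_of w t s"
  proof (cases "t = z")
    case True
    have "0 < j" "j < z" using C(2)[of j] j(1) by auto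
    then have "left_of w j z" using left_of_if_same_label[OF w] ts(3) True by auto
    then have "left_of w j s" using left_of_trans[OF w] ts(5) True by auto
    then show ?thesis using j(1) s ts(4) by blast
  qed (use ts s in blast)
qed

text \<open>A chain packing of an arbitrary set of letters can be pushed down to an initial segment of the
  alphabet: as long as some small letter \<open>i\<close> is missing, there is a class with a letter larger than \<open>i\<close>,
  and in that class the greatest letter can be exchanged for \<open>i\<close>. Each exchange decreases the sum of
  the letters and keeps the sizes of all classes.\<close>

lemma packing_exchange:
  assumes w: "distinct w" "set w = {1..n}" and P: "packing k w U P" "U \<subseteq> {1..n}"
  shows "packable k w (card U)"
  using P
proof (induction "\<Sum>U" arbitrary: U P rule: less_induct)
  case less
  have finU: "finite U" using less.prems(2) by (rule finite_subset) simp
  have card_n: "card U \<le> n" using card_mono[OF _ less.prems(2)] by simp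
  show ?case
  proof (cases "U = {1..card U}")
    case True
    then show ?thesis using less.prems(1) w(2) card_n unfolding packable_def by fastforce
  next
    case False
    then have "\<not> U \<subseteq> {1..card U}" using card_subset_eq[of "{1..card U}" U] by auto
    moreover have "\<not> {1..card U} \<subseteq> U" using card_subset_eq[of U "{1..card U}"] finU False by auto
    \<comment> \<open>Both differences are nonempty because the two sets have the same cardinality.\<close>
    ultimately obtain i t where "i \<in> {1..card U}" and i: "i \<notin> U"
        and t: "t \<in> U" and "t \<notin> {1..card U}"
      by blast
    moreover from t have "1 \<le> t" using less.prems(2) by auto
    ultimately have i: "i \<notin> U" "1 \<le> i" "i \<le> card U" and t: "t \<in> U" "card U < t"
      by auto
    obtain C where C: "C \<in> P" "t \<in> C" using less.prems(1) t(1) by (auto simp: packing_def)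
    have CU: "C \<subseteq> U" using C(1) less.prems(1) by (auto simp: packing_def)
    have finC: "finite C" using CU finU by (rule finite_subset)
    define z where "z = Max C"
    have z: "z \<in> C" "\<And>j. j \<in> C \<Longrightarrow> j \<le> z" unfolding z_def using finC C(2) by (auto intro: Max_in)
    have iz: "i < z" using i(3) t(2) z(2)[OF C(2)] by linarith
    define C' where "C' = insert i (C - {z})"
    define U' where "U' = insert i (U - {z})"
    have iC: "i \<notin> C" using CU i(1) by auto
    have "chain w C" using C(1) less.prems(1) by (auto simp: packing_def)
    then have "chain w (insert i C)"
      by (rule chain_insert_below[OF _ C(2)]) (use i t in linarith)
    then have "chain w (insert i C - {z})"
    proof (rule chain_remove_greatest[OF w(1)])
      fix j assume "j \<in> insert i C"
      then show "0 < j \<and> j \<le> z"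
        using i(2) iz z(2) CU less.prems(2) by (auto simp: subset_iff Suc_le_eq)
    qed
    then have chain': "chain w C'" using iz unfolding C'_def by (simp add: insert_Diff_if)
    have "card C' = Suc (card (C - {z}))"
      unfolding C'_def by (rule card_insert_disjoint) (use finC iC in auto)
    also have "\<dots> = card C" by (rule card_Suc_Diff1[OF finC z(1)])
    finally have card': "card C' \<le> k" using C(1) less.prems(1) by (auto simp: packing_def)
    have "packing k w U' (insert C' (P - {C}))"
      unfolding packing_def
    proof (intro conjI ballI)
      show "\<Union> (insert C' (P - {C})) = U'"
        using less.prems(1) C(1) z(1) unfolding packing_def C'_def U'_def
        by (auto simp: disjoint_def)
      show "disjoint (insert C' (P - {C}))"
        using less.prems(1) C(1) i(1) unfolding packing_def C'_def
        by (auto simp: disjoint_def)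
    next
      fix B assume "B \<in> insert C' (P - {C})"
      then show "card B \<le> k" "chain w B"
        using less.prems(1) card' chain' by (auto simp: packing_def)
    qed
    moreover have "\<Sum>U' < \<Sum>U"
    proof -
      have "z \<in> U" using z(1) CU by auto
      then have "\<Sum>U = z + \<Sum>(U - {z})" using sum.remove[OF finU, of z "\<lambda>x. x"] by simp
      moreover have "\<Sum>U' = i + \<Sum>(U - {z})" unfolding U'_def using i(1) finU by simp
      ultimately show ?thesis using iz by simp
    qed
    moreover have "U' \<subseteq> {1..n}" using less.prems(2) i card_n unfolding U'_def by auto
    moreover have "card U' = card U"
    proof -
      have "card U' = Suc (card (U - {z}))"
        unfolding U'_def by (rule card_insert_disjoint) (use finU i(1) in auto)
      also have "\<dots> = card U" by (rule card_Suc_Diff1[OF finU]) (use z(1) CU in auto)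
      finally show ?thesis .
    qed
    ultimately show ?thesis using less.hyps[of U'] by metis
  qed
qed

section \<open>Invariance under Knuth moves\<close>

lemma less_if_cc_label_less: "cc_label w s < cc_label w t \<Longrightarrow> s < t"
  using cc_label_mono[of t s w] by (cases "t \<le> s") auto

lemma cc_label_cong:
  assumes "\<And>i. 0 < i \<Longrightarrow> left_of w i (Suc i) = left_of w' i (Suc i)"
  shows "cc_label w j = cc_label w' j"
proof (induction j)
  case (Suc j)
  then show ?case using assms[of j] by (cases j) auto
qed simp

inductive knuth_equiv :: "nat list \<Rightarrow> nat list \<Rightarrow> bool" (infix "\<approx>" 50) where
  knuth_refl: "w \<approx> w"
| knuth_sym: "v \<approx> w \<Longrightarrow> w \<approx> v"
| knuth_trans: "u \<approx> v \<Longrightarrow> v \<approx> w \<Longrightarrow> u \<approx> w"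
| knuth_xzy: "x < y \<Longrightarrow> y < z \<Longrightarrow> a @ [x, z, y] @ b \<approx> a @ [z, x, y] @ b"
| knuth_yxz: "x < y \<Longrightarrow> y < z \<Longrightarrow> a @ [y, x, z] @ b \<approx> a @ [y, z, x] @ b"

declare knuth_trans [trans]

lemma knuth_equiv_mset: "v \<approx> w \<Longrightarrow> mset v = mset w"
  by (induction rule: knuth_equiv.induct) auto

lemma knuth_equiv_context: "v \<approx> w \<Longrightarrow> a @ v @ b \<approx> a @ w @ b"
proof (induction rule: knuth_equiv.induct)
  case (knuth_xzy x y z a' b')
  then show ?case using knuth_equiv.knuth_xzy[of x y z "a @ a'" "b' @ b"] by simp
next
  case (knuth_yxz x y z a' b')
  then show ?case using knuth_equiv.knuth_yxz[of x y z "a @ a'" "b' @ b"] by simp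
qed (blast intro: knuth_equiv.intros)+

text \<open>The move to the word in which \<open>z\<close> precedes \<open>x\<close> destroys no chain: the pair that is lost has its
  smaller letter on the left and never witnesses a chain condition. Labels do not change, since only
  the relative order of the nonconsecutive letters \<open>x\<close> and \<open>z\<close> does.\<close>

lemma packable_swap_forward:
  assumes left: "\<And>p q. left_of w' p q \<longleftrightarrow> (left_of w p q \<and> \<not> (p = x \<and> q = z)) \<or> (p = z \<and> q = x)"
    and "Suc x < z" and set: "set w' = set w"
    and "packable k w m"
  shows "packable k w' m"
proof -
  have lab: "cc_label w' j = cc_label w j" for j
    by (rule cc_label_cong) (use left assms(2) in auto)
  have "chain w' C" if C: "chain w C" for C
    unfolding chain_def lab
  proof (intro ballI impI)
    fix j assume "j \<in> C" "0 < cc_label w j"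
    then obtain t s where ts: "t \<in> C" "s \<in> C" "cc_label w t = cc_label w j"
      "Suc (cc_label w s) = cc_label w j" "left_of w t s" using chainE[OF C] by blast
    have "\<not> (t = x \<and> s = z)" using ts(3,4) cc_label_mono[of x z w] assms(2) by auto
    then show "\<exists>t\<in>C. \<exists>s\<in>C. cc_label w t = cc_label w j
      \<and> Suc (cc_label w s) = cc_label w j \<and> left_of w' t s" using ts left by blast
  qed
  then show ?thesis using assms(4) unfolding packable_def packing_def set by blast
qed

text \<open>An exchange of two letters with the same label maps chains to chains as soon as it respects the
  pairs that can serve as witnesses.\<close>

lemma chain_exchange_image:
  assumes lab: "\<And>j. cc_label w' j = cc_label w j" "cc_label w x = cc_label w y"
    and C: "chain w C"
    and left: "\<And>t s. t \<in> C \<Longrightarrow> s \<in> C \<Longrightarrow> left_of w t s \<Longrightarrow>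
        cc_label w t = Suc (cc_label w s) \<Longrightarrow>
        left_of w' (transpose x y t) (transpose x y s)"
  shows "chain w' (transpose x y ` C)"
proof -
  have lab': "cc_label w (transpose x y j) = cc_label w j" for j
    using lab(2) by (auto simp: transpose_def)
  show ?thesis unfolding chain_def lab(1)
  proof (intro ballI impI)
    fix j assume "j \<in> transpose x y ` C" "0 < cc_label w j"
    then obtain i where i: "i \<in> C" "cc_label w i = cc_label w j" "0 < cc_label w i" using lab' by auto
    obtain t s where ts: "t \<in> C" "s \<in> C" "cc_label w t = cc_label w i"
      "Suc (cc_label w s) = cc_label w i" "left_of w t s" using chainE[OF C i(1,3)] by blast
    then have "left_of w' (transpose x y t) (transpose x y s)" using left by simp
    then show "\<exists>t\<in>transpose x y ` C. \<exists>s\<in>transpose x y ` C. cc_label w t = cc_label w j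
      \<and> Suc (cc_label w s) = cc_label w j \<and> left_of w' t s" using ts i(2) lab' by fastforce
  qed
qed

lemma packing_transpose_image:
  assumes P: "packing k w U P" and lab: "\<And>j. cc_label w' j = cc_label w j" "cc_label w x = cc_label w y"
    and U: "x \<in> U" "y \<in> U"
    and left: "\<And>t s C. C \<in> P \<Longrightarrow> t \<in> C \<Longrightarrow> s \<in> C \<Longrightarrow> left_of w t s \<Longrightarrow>
        cc_label w t = Suc (cc_label w s) \<Longrightarrow>
        left_of w' (transpose x y t) (transpose x y s)"
  shows "packing k w' U ((`) (transpose x y) ` P)"
proof -
  have inj: "inj_on (transpose x y) A" for A by (rule inj_onI) (metis transpose_involutory)
  show ?thesis
    unfolding packing_def
  proof (intro conjI ballI)
    have "\<Union> ((`) (transpose x y) ` P) = transpose x y ` U" using P by (auto simp: packing_def)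
    also have "\<dots> = U" using U by simp
    finally show "\<Union> ((`) (transpose x y) ` P) = U" .
    have "disjoint P" using P by (simp add: packing_def)
    then show "disjoint ((`) (transpose x y) ` P)"
      by (rule disjoint_image[OF inj])
  next
    fix C assume "C \<in> (`) (transpose x y) ` P"
    then obtain B where B: "B \<in> P" "C = transpose x y ` B" by blast
    then show "card C \<le> k" using P by (simp add: packing_def card_image[OF inj])
    show "chain w' C" unfolding B(2)
      by (rule chain_exchange_image[OF lab]) (use P B(1) left in \<open>auto simp: packing_def\<close>)
  qed
qed

text \<open>In the opposite direction, the pair of \<open>z\<close> and \<open>x\<close> may be the witness of a condition in a class \<open>C\<close>, with
  labels \<open>l + 1\<close> and \<open>l\<close>. The third letter \<open>y\<close> has one of these two labels, and since equal labels
  increase from left to right, it shares its label with its neighbour \<open>p\<close>, which is \<open>x\<close> in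
  \<open>z x y\<close> and \<open>z\<close> in \<open>y z x\<close>. If \<open>y\<close> is in \<open>C\<close>, it replaces \<open>p\<close> as a witness. Otherwise \<open>y\<close> and \<open>p\<close> exchange
  their classes; as these two letters are separated by at most one letter, every other witness
  survives.\<close>

lemma packable_swap_backward:
  assumes xyz: "x < y" "y < z" and w: "distinct w" "set w = {1..n}"
    and shape: "w = a @ [z, x, y] @ b \<and> w' = a @ [x, z, y] @ b \<and> p = x \<or>
      w = a @ [y, z, x] @ b \<and> w' = a @ [y, x, z] @ b \<and> p = z"
    and "packable k w m"
  shows "packable k w' m"
proof -
  have left: "left_of w' t s \<longleftrightarrow> (left_of w t s \<and> \<not> (t = z \<and> s = x)) \<or> (t = x \<and> s = z)" for t s
    using shape w(1) by (auto dest: left_of_in_set)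
  have set: "set w' = set w" using shape by auto
  have pos: "0 < x" "0 < y" using shape w(2) by fastforce+
  have lab: "cc_label w' j = cc_label w j" for j
    by (rule cc_label_cong) (use left xyz in auto)
  obtain P where P: "packing k w {1..m} P" and m: "{1..m} \<subseteq> set w"
    using assms(6) by (auto simp: packable_def)
  have labp: "cc_label w p = cc_label w y" if "cc_label w z = Suc (cc_label w x)"
  proof -
    have "cc_label w y = cc_label w x \<or> cc_label w y = cc_label w z"
      using that cc_label_mono[of x y w] cc_label_mono[of y z w] xyz by linarith
    moreover have "left_of w y z" if "cc_label w y = cc_label w z"
      using left_of_if_same_label[OF w(1) pos(2) xyz(2) that] .
    moreover have "left_of w x y" if "cc_label w y = cc_label w x"
      using left_of_if_same_label[OF w(1) pos(1) xyz(1)] that by simp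
    ultimately show ?thesis using shape w(1) by (auto dest: left_of_in_set)
  qed
  show ?thesis
  proof (cases "cc_label w z = Suc (cc_label w x) \<and> (\<exists>C\<in>P. x \<in> C \<and> z \<in> C \<and> y \<notin> C)")
    case True
    \<comment> \<open>Since \<open>C0\<close> contains \<open>x\<close> and \<open>z\<close>, no class contains \<open>y\<close> together with one of them.\<close>
    then obtain C0 where C0: "C0 \<in> P" "x \<in> C0" "z \<in> C0" "y \<notin> C0" by blast
    have xzU: "x \<in> {1..m}" "z \<in> {1..m}" using P C0 by (auto simp: packing_def)
    then have yU: "y \<in> {1..m}" using xyz by auto
    have excl: "\<not> (x \<in> C \<and> y \<in> C)" "\<not> (z \<in> C \<and> y \<in> C)" if "C \<in> P" for C
      using P C0 that by (auto simp: packing_def disjoint_def)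
    have "packing k w' {1..m} ((`) (transpose p y) ` P)"
    proof (rule packing_transpose_image[OF P lab labp])
      fix t s C assume "C \<in> P" "t \<in> C" "s \<in> C" "left_of w t s"
      then show "left_of w' (transpose p y t) (transpose p y s)"
        using excl[of C] shape w(1) xyz by (auto simp: transpose_def dest: left_of_in_set)
    qed (use True shape xzU yU in auto)
    then show ?thesis using m set by (auto simp: packable_def)
  next
    case False
    have "chain w' C" if "C \<in> P" for C
      unfolding chain_def lab
    proof (intro ballI impI)
      have C: "chain w C" using that P by (auto simp: packing_def)
      fix j assume j: "j \<in> C" "0 < cc_label w j"
      obtain t s where ts: "t \<in> C" "s \<in> C" "cc_label w t = cc_label w j"
        "Suc (cc_label w s) = cc_label w j" "left_of w t s" using chainE[OF C j] by blast
      show "\<exists>t\<in>C. \<exists>s\<in>C. cc_label w t = cc_label w j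
        \<and> Suc (cc_label w s) = cc_label w j \<and> left_of w' t s"
      proof (cases "t = z \<and> s = x")
        case True
        then have lz: "cc_label w z = Suc (cc_label w x)" using ts by simp
        then have "y \<in> C" using True False ts that by blast
        moreover have "left_of w' z y \<and> p = x \<or> left_of w' y x \<and> p = z" using shape by auto
        ultimately show ?thesis using True ts labp[OF lz] by metis
      qed (use ts left in blast)
    qed
    then show ?thesis using P m set unfolding packable_def packing_def by metis
  qed
qed

lemma packable_knuth_invariant:
  assumes "v \<approx> w" "distinct v" "set v = {1..n}"
  shows "packable k v m \<longleftrightarrow> packable k w m"
  using assms
proof (induction rule: knuth_equiv.induct)
  case (knuth_sym v w)
  then show ?case by (metis knuth_equiv_mset mset_eq_setD mset_eq_imp_distinct_iff)
next
  case (knuth_trans u v w)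
  then show ?case by (metis knuth_equiv_mset mset_eq_setD mset_eq_imp_distinct_iff)
next
  case (knuth_xzy x y z a b)
  show ?case
  proof
    assume "packable k (a @ [x, z, y] @ b) m"
    then show "packable k (a @ [z, x, y] @ b) m"
      by (rule packable_swap_forward[rotated 3, where x = x and z = z])
        (use knuth_xzy in \<open>auto dest: left_of_in_set\<close>)
  next
    assume "packable k (a @ [z, x, y] @ b) m"
    then show "packable k (a @ [x, z, y] @ b) m"
      by (rule packable_swap_backward[rotated 5, where p = x and x = x and y = y and z = z and n = n])
        (use knuth_xzy in auto)
  qed
next
  case (knuth_yxz x y z a b)
  show ?case
  proof
    assume "packable k (a @ [y, x, z] @ b) m"
    then show "packable k (a @ [y, z, x] @ b) m"
      by (rule packable_swap_forward[rotated 3, where x = x and z = z])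
        (use knuth_yxz in \<open>auto dest: left_of_in_set\<close>)
  next
    assume "packable k (a @ [y, z, x] @ b) m"
    then show "packable k (a @ [y, x, z] @ b) m"
      by (rule packable_swap_backward[rotated 5, where p = z and x = x and y = y and z = z and n = n])
        (use knuth_yxz in auto)
  qed
qed simp

section \<open>Row insertion: Knuth equivalence and tableaux\<close>

lemma row_insert_cases:
  assumes "row_insert x r = (r', b)"
  obtains (append) "r' = r @ [x]" "b = None" "\<forall>u\<in>set r. u \<le> x"
  | (bump) u v y where "r = u @ y # v" "r' = u @ x # v" "b = Some y" "x < y" "\<forall>u\<in>set u. u \<le> x"
proof -
  have "(r' = r @ [x] \<and> b = None \<and> (\<forall>u\<in>set r. u \<le> x)) \<or>
    (\<exists>u v y. r = u @ y # v \<and> r' = u @ x # v \<and> b = Some y \<and> x < y \<and> (\<forall>u\<in>set u. u \<le> x))"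
    using assms
  proof (induction r arbitrary: r' b)
    case (Cons h r)
    show ?case
    proof (cases "x < h")
      case True
      then show ?thesis
        using Cons.prems by (intro disjI2 exI[of _ "[]"] exI[of _ r] exI[of _ h]) auto
    next
      case False
      obtain r'' where r'': "row_insert x r = (r'', b)" "r' = h # r''"
        using Cons.prems False by (auto split: prod.splits)
      from Cons.IH[OF r''(1)] show ?thesis
      proof (elim disjE exE conjE)
        fix u v y
        assume "r = u @ y # v" "r'' = u @ x # v" "b = Some y" "x < y" "\<forall>u\<in>set u. u \<le> x"
        then show ?thesis
          using False r''(2) by (intro disjI2 exI[of _ "h # u"] exI[of _ v] exI[of _ y]) auto
      qed (use False r''(2) in auto)
    qed
  qed simp
  then show ?thesis using that by blast
qed

lemma knuth_move_left_past_larger: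
  assumes "x < y" "sorted_wrt (<) (y # v)"
  shows "(y # v) @ [x] \<approx> y # x # v"
  using assms
proof (induction v arbitrary: y)
  case (Cons h v)
  have "(y # h # v) @ [x] \<approx> [y, h] @ x # v"
    using knuth_equiv_context[OF Cons.IH[of h], of "[y]" "[]"] Cons.prems by simp
  also have "[y, h] @ x # v = [] @ [y, h, x] @ v" by simp
  also have "[] @ [y, h, x] @ v \<approx> [] @ [y, x, h] @ v"
    using knuth_yxz[of x y h "[]" v] Cons.prems by (auto intro: knuth_sym)
  finally show ?case by simp
qed (simp add: knuth_refl)

lemma knuth_move_left_past_smaller:
  assumes "x < y" "sorted_wrt (<) (u @ [x])"
  shows "u @ [y, x] \<approx> y # u @ [x]"
  using assms
proof (induction u arbitrary: x rule: rev_induct)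
  case (snoc h u)
  have h: "h < x" "sorted_wrt (<) (u @ [h])" using snoc.prems by (auto simp: sorted_wrt_append)
  have "u @ [h, y, x] @ [] \<approx> u @ [y, h, x] @ []"
    by (rule knuth_xzy) (use h snoc.prems in auto)
  also have "\<dots> \<approx> (y # u @ [h]) @ [x]"
    using knuth_equiv_context[OF snoc.IH[OF _ h(2)], of "[]" "[x]"] h snoc.prems by simp
  finally show ?case by simp
qed (simp add: knuth_refl)

text \<open>The inserted letter \<open>x\<close> first moves left until it is next to the letter \<open>y\<close> that it bumps, and then
  \<open>y\<close> moves left to the front of the row.\<close>

lemma row_bump_knuth:
  assumes "sorted_wrt (<) (u @ y # v)" "x < y" "\<forall>u\<in>set u. u < x"
  shows "(u @ y # v) @ [x] \<approx> y # u @ x # v"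
proof -
  have "u @ ((y # v) @ [x]) @ [] \<approx> u @ (y # x # v) @ []"
    by (rule knuth_equiv_context, rule knuth_move_left_past_larger)
      (use assms in \<open>auto simp: sorted_wrt_append\<close>)
  also have "u @ (y # x # v) @ [] = [] @ (u @ [y, x]) @ v" by simp
  also have "\<dots> \<approx> [] @ (y # u @ [x]) @ v"
    by (rule knuth_equiv_context, rule knuth_move_left_past_smaller)
      (use assms in \<open>auto simp: sorted_wrt_append\<close>)
  finally show ?thesis by simp
qed

fun is_tableau :: "nat list list \<Rightarrow> bool" where
  "is_tableau [] \<longleftrightarrow> True"
| "is_tableau (r # T) \<longleftrightarrow> sorted_wrt (<) r \<and> length (first_row T) \<le> length r \<and>
     (\<forall>i<length (first_row T). r ! i < first_row T ! i) \<and> is_tableau T"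

lemma reading_word_Nil [simp]: "reading_word [] = []"
  by (simp add: reading_word_def)

lemma reading_word_Cons [simp]: "reading_word (r # T) = reading_word T @ r"
  by (simp add: reading_word_def)

lemma first_row_simps [simp]: "first_row [] = []" "first_row (r # T) = r"
  by (simp_all add: first_row_def)

lemma first_row_tableau_insert: "first_row (tableau_insert x T) = fst (row_insert x (first_row T))"
  by (cases T) (auto split: prod.splits option.splits)

lemma tableau_insert_knuth:
  assumes "is_tableau T" "x \<notin> set (reading_word T)" "distinct (reading_word T)"
  shows "reading_word T @ [x] \<approx> reading_word (tableau_insert x T)"
  using assms
proof (induction T arbitrary: x)
  case (Cons r T)
  obtain r' b where ins: "row_insert x r = (r', b)" by fastforce
  from ins show ?case
  proof (cases rule: row_insert_cases)
    case append
    then show ?thesis using ins by (simp add: knuth_refl)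
  next
    case (bump u v y)
    have "reading_word T @ (r @ [x]) @ [] \<approx> reading_word T @ (y # r') @ []"
      unfolding bump(1,2)
      by (rule knuth_equiv_context, rule row_bump_knuth)
        (use Cons.prems bump in \<open>auto simp: le_less\<close>)
    also have "reading_word T @ (y # r') @ [] = [] @ (reading_word T @ [y]) @ r'" by simp
    also have "\<dots> \<approx> [] @ reading_word (tableau_insert y T) @ r'"
      by (rule knuth_equiv_context, rule Cons.IH) (use Cons.prems bump in auto)
    finally show ?thesis using ins bump by simp
  qed
qed (simp add: knuth_refl)

text \<open>The entry \<open>y\<close> that is bumped from position \<open>p\<close> enters the next row at a position not exceeding \<open>p\<close>,
  because the old entry above \<open>y\<close>, if any, is larger than \<open>y\<close>. So what is below \<open>y\<close> afterwards is either
  the inserted letter \<open>x < y\<close> or an earlier entry of the row of \<open>y\<close>.\<close>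

lemma is_tableau_insert:
  assumes "is_tableau T" "x \<notin> set (reading_word T)" "distinct (reading_word T)"
  shows "is_tableau (tableau_insert x T)"
  using assms
proof (induction T arbitrary: x)
  case (Cons r T)
  obtain r' b where ins: "row_insert x r = (r', b)" by fastforce
  from ins show ?case
  proof (cases rule: row_insert_cases)
    case append
    have "\<forall>u\<in>set r. u < x" using append(3) Cons.prems(2) by (auto simp: le_less)
    then show ?thesis using ins append Cons.prems
      by (auto simp: sorted_wrt_append nth_append)
  next
    case (bump u v y)
    define q where "q = first_row T"
    have xr: "\<forall>h\<in>set u. h < x" using bump Cons.prems(2) by (auto simp: le_less)
    have sorted': "sorted_wrt (<) r'"
      using Cons.prems(1) bump xr by (auto simp: sorted_wrt_append)
    have q: "length q \<le> length r" "\<And>i. i < length q \<Longrightarrow> r ! i < q ! i"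
      using Cons.prems(1) by (auto simp: q_def)
    have r': "length r' = length r" "r' ! length u = x" "\<And>i. i \<noteq> length u \<Longrightarrow> r' ! i = r ! i"
      "r ! length u = y"
      using bump by (auto simp: nth_append nth_Cons')
    have r'le: "r' ! i \<le> r ! i" for i using r' bump(4) by (cases "i = length u") auto
    have len_u: "length u < length r" using bump(1) by simp
    have IH: "is_tableau (tableau_insert y T)"
      by (rule Cons.IH) (use Cons.prems bump in auto)
    obtain q' b' where q': "row_insert y q = (q', b')" by fastforce
    have "length q' \<le> length r' \<and> (\<forall>i<length q'. r' ! i < q' ! i)"
      using q'
    proof (cases rule: row_insert_cases)
      case append
      have "length q \<le> length u"
      proof (rule ccontr)
        assume *: "\<not> length q \<le> length u"
        then have "y < q ! length u" using q(2)[of "length u"] r'(4) by simp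
        moreover have "q ! length u \<le> y" using append(3) * by simp
        ultimately show False by simp
      qed
      moreover have "r' ! length q < y"
      proof (cases "length q = length u")
        case False
        then have "r' ! length q \<in> set u"
          using \<open>length q \<le> length u\<close> bump(2) by (simp add: nth_append)
        then show ?thesis using xr bump(4) by fastforce
      qed (use r' bump(4) in simp)
      ultimately show ?thesis
        using append(1) len_u r' q r'le by (auto simp: nth_append less_Suc_eq intro: le_less_trans)
    next
      case (bump u' v' z)
      note second = this
      have len_u': "length u' \<le> length u"
      proof (rule ccontr)
        assume *: "\<not> length u' \<le> length u"
        then have "y < q ! length u" using q(2)[of "length u"] r'(4) bump(1) by simp
        moreover have "q ! length u \<le> y"
          using bump(1,5) * by (simp add: nth_append)
        ultimately show False by simp
      qed
      have small: "r' ! length u' < y"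
      proof (cases "length u' = length u")
        case False
        then have "r' ! length u' \<in> set u"
          using len_u' \<open>r' = u @ x # v\<close> by (simp add: nth_append)
        then show ?thesis using xr \<open>x < y\<close> by fastforce
      qed (use r' \<open>x < y\<close> in simp)
      have "q' ! i = (if i = length u' then y else q ! i)" "length q' = length q" for i
        using second(1,2) by (auto simp: nth_append nth_Cons')
      moreover have "r' ! i < q ! i" if "i < length q" for i
        using le_less_trans[OF r'le q(2)[OF that]] .
      ultimately show ?thesis using r' q(1) small by auto
    qed
    then show ?thesis
      using ins bump sorted' IH q' by (simp add: first_row_tableau_insert q_def)
  qed
qed simp

lemma insertion_tableau_snoc:
  "insertion_tableau (w @ [x]) = tableau_insert x (insertion_tableau w)"
  by (simp add: insertion_tableau_def)

lemma insertion_tableau_knuth: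
  assumes "distinct w"
  shows "is_tableau (insertion_tableau w) \<and> w \<approx> reading_word (insertion_tableau w)"
  using assms
proof (induction w rule: rev_induct)
  case Nil
  then show ?case by (simp add: insertion_tableau_def knuth_refl)
next
  case (snoc x w)
  let ?T = "insertion_tableau w"
  have IH: "is_tableau ?T" "w \<approx> reading_word ?T" using snoc by auto
  have fresh: "x \<notin> set (reading_word ?T)" "distinct (reading_word ?T)"
    using knuth_equiv_mset[OF IH(2)] snoc.prems
    by (auto dest: mset_eq_setD mset_eq_imp_distinct_iff)
  have "w @ [x] \<approx> reading_word ?T @ [x]"
    using knuth_equiv_context[OF IH(2), of "[]" "[x]"] by simp
  also have "reading_word ?T @ [x] \<approx> reading_word (tableau_insert x ?T)"
    by (rule tableau_insert_knuth[OF IH(1) fresh])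
  finally show ?case
    using is_tableau_insert[OF IH(1) fresh] by (simp add: insertion_tableau_snoc)
qed

section \<open>Moving the first row to the front\<close>

text \<open>The rotation reverses exactly those pairs \<open>i, i + 1\<close> that are split between \<open>v\<close> and \<open>r\<close>. On the way from
  \<open>1\<close>, which is in \<open>r\<close>, to \<open>j\<close>, each passage from \<open>r\<close> to \<open>v\<close> raises the label in \<open>v @ r\<close> only, and
  each passage back raises the label in \<open>r @ v\<close> only.\<close>

lemma cc_label_rotate:
  assumes w: "distinct (v @ r)" "set (v @ r) = {1..n}" "1 \<in> set r" and "1 \<le> j" "j \<le> n"
  shows "cc_label (v @ r) j = cc_label (r @ v) j + (if j \<in> set v then 1 else 0)"
  using assms(4,5)
proof (induction j rule: dec_induct)
  case base
  then show ?case using w by auto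
next
  case (step j)
  have "j \<in> set v \<union> set r" "Suc j \<in> set v \<union> set r" using w(2) step by auto
  moreover have "cc_label (v @ r) j = cc_label (r @ v) j + (if j \<in> set v then 1 else 0)"
    using step by simp
  ultimately show ?case
    using step(1) w(1) by (auto simp: cc_label_Suc dest: left_of_in_set)
qed

text \<open>A pair whose larger letter is on the left cannot lie within the increasing word \<open>r\<close>. This restricts
  where the letters of a witnessing pair can be.\<close>

lemma left_of_across_sorted:
  assumes "distinct (v @ r)" "sorted_wrt (<) r" "s < t"
  shows "left_of (v @ r) t s \<Longrightarrow> t \<in> set v \<and> (s \<in> set r \<or> s \<in> set v \<and> left_of v t s)"
    and "left_of (r @ v) t s \<Longrightarrow> s \<in> set v \<and> (t \<in> set r \<or> t \<in> set v \<and> left_of v t s)"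
  using assms(3) by (auto simp: left_of_sorted[OF assms(2)] dest: left_of_in_set)

text \<open>A chain in \<open>v @ r\<close> without its letters of label \<open>0\<close> is a chain in \<open>r @ v\<close>: letters of \<open>v\<close> drop by one label,
  and where a letter of \<open>r\<close> keeps its label, it now stands to the left of the letters of \<open>v\<close> that were
  its equals before and have dropped below it. Every nonempty class loses a letter this way, and the
  letters of label \<open>0\<close> become classes of their own.\<close>

lemma packable_rotate_forward:
  assumes w: "distinct (v @ r)" "set (v @ r) = {1..n}" "1 \<in> set r" and r: "sorted_wrt (<) r"
    and "1 \<le> k" "packable (Suc k) (v @ r) m"
  shows "packable k (r @ v) m"
proof -
  define a where "a = cc_label (v @ r)"
  define b where "b = cc_label (r @ v)"
  obtain P where P: "\<Union>P = {1..m}" "disjoint P" "\<And>C. C \<in> P \<Longrightarrow> card C \<le> Suc k \<and> chain (v @ r) C"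
    and m: "{1..m} \<subseteq> set (v @ r)"
    using assms(6) by (auto simp: packable_def packing_def)
  have ab: "a j = b j + (if j \<in> set v then 1 else 0)" if "j \<in> {1..m}" for j
    unfolding a_def b_def by (rule cc_label_rotate[OF w]) (use that m w(2) in auto)
  have vr: "j \<in> set v \<or> j \<in> set r" "\<not> (j \<in> set v \<and> j \<in> set r)" if "j \<in> {1..m}" for j
    using that m w(1) by auto
  define Z where "Z = {j \<in> {1..m}. a j = 0}"
  have "chain (r @ v) (C - Z)" if C: "C \<in> P" for C
    unfolding chain_def b_def[symmetric]
  proof (intro ballI impI)
    have CU: "\<And>i. i \<in> C \<Longrightarrow> i \<in> {1..m}" using C P(1) by blast
    have keep: "i \<in> C - Z" if "i \<in> C" "0 < a i" for i using that by (auto simp: Z_def)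
    have wit: "\<exists>t\<in>C. \<exists>s\<in>C. a t = a i \<and> Suc (a s) = a i \<and> t \<in> set v
        \<and> (s \<in> set r \<or> s \<in> set v \<and> left_of v t s)" if i: "i \<in> C" "0 < a i" for i
    proof -
      obtain t s where ts: "t \<in> C" "s \<in> C" "a t = a i" "Suc (a s) = a i" "left_of (v @ r) t s"
        using chainE[OF conjunct2[OF P(3)[OF C]] i(1)] i(2) unfolding a_def by blast
      moreover have "s < t" by (rule less_if_cc_label_less[of "v @ r"]) (use ts in \<open>simp add: a_def\<close>)
      ultimately show ?thesis using left_of_across_sorted(1)[OF w(1) r] by blast
    qed
    \<comment> \<open>The old witness \<open>t\<close> is in \<open>v\<close> and has the label of \<open>i\<close>; after the rotation it is one label
      below \<open>i\<close> and to its right.\<close>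
    have in_r: "\<exists>t\<in>C - Z. \<exists>s\<in>C - Z. b t = b i \<and> Suc (b s) = b i \<and> left_of (r @ v) t s"
      if i: "i \<in> C" "i \<in> set r" "0 < b i" for i
    proof -
      have ai: "a i = b i" using ab[OF CU[OF i(1)]] vr[OF CU[OF i(1)]] i(2) by auto
      obtain t where t: "t \<in> C" "a t = a i" "t \<in> set v" using wit[of i] i ai by auto
      then have "left_of (r @ v) i t" using i(2) by simp
      moreover have "Suc (b t) = b i" using ab[OF CU[OF t(1)]] t ai by simp
      ultimately show ?thesis using keep[of i] keep[of t] i t ai by auto
    qed
    fix j assume "j \<in> C - Z" "0 < b j"
    then have j: "j \<in> C" "0 < b j" by auto
    show "\<exists>t\<in>C - Z. \<exists>s\<in>C - Z. b t = b j \<and> Suc (b s) = b j \<and> left_of (r @ v) t s"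
    proof (cases "j \<in> set r")
      case True
      then show ?thesis using in_r j by blast
    next
      case False
      then have aj: "a j = Suc (b j)" using ab[OF CU[OF j(1)]] vr[OF CU[OF j(1)]] by auto
      then obtain t s where ts: "t \<in> C" "s \<in> C" "a t = a j" "Suc (a s) = a j" "t \<in> set v"
        and s: "s \<in> set r \<or> s \<in> set v \<and> left_of v t s"
        using wit[of j] j by auto
      from s show ?thesis
      proof
        \<comment> \<open>Then \<open>s\<close> keeps its label while \<open>j\<close> drops to it, so the condition for \<open>j\<close> is that for \<open>s\<close>.\<close>
        assume "s \<in> set r"
        moreover from this have "b s = b j"
          using ab[OF CU[OF ts(2)]] vr[OF CU[OF ts(2)]] aj ts(4) by auto
        ultimately show ?thesis using in_r[of s] j ts(2) by auto
      next
        assume s: "s \<in> set v \<and> left_of v t s"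
        then have "b t = b j" "Suc (b s) = b j"
          using ab[OF CU[OF ts(1)]] ab[OF CU[OF ts(2)]] ts aj by auto
        then show ?thesis using keep[of t] keep[of s] ts aj s j by auto
      qed
    qed
  qed
  moreover have "card (C - Z) \<le> k" if C: "C \<in> P" for C
  proof (cases "C = {}")
    case False
    then obtain j where "j \<in> C" by blast
    then obtain z where z: "z \<in> C" "a z = 0"
      using chain_has_all_smaller_labels[of "v @ r" C j 0] P(3)[OF C] by (auto simp: a_def)
    moreover have "finite C" using C P(1) by (metis Union_upper finite_atLeastAtMost finite_subset)
    moreover have "z \<in> Z" using z C P(1) by (auto simp: Z_def)
    ultimately have "card (C - Z) < card C" by (intro psubset_card_mono) auto
    then show ?thesis using P(3)[OF C] by auto
  qed simp
  moreover have "chain (r @ v) {z}" if "z \<in> Z" for z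
    using that ab[of z] by (auto simp: chain_def Z_def b_def)
  moreover have "disjoint ((\<lambda>C. C - Z) ` P \<union> (\<lambda>z. {z}) ` Z)"
    using P(2) by (auto simp: disjoint_def) 
  moreover have "\<Union>((\<lambda>C. C - Z) ` P \<union> (\<lambda>z. {z}) ` Z) = {1..m}"
    using P(1) by (auto simp: Z_def)
  ultimately have "packing k (r @ v) {1..m} ((\<lambda>C. C - Z) ` P \<union> (\<lambda>z. {z}) ` Z)"
    using assms(5) unfolding packing_def by auto
  then show ?thesis using m unfolding packable_def by auto
qed

text \<open>The construction of the forward direction is undone. The letters of label \<open>0\<close> in \<open>v @ r\<close> are taken out of
  their classes; what remains of a class is empty or contains a letter of \<open>v\<close> whose label in \<open>v @ r\<close> is
  \<open>1\<close>. Provided that there are at least as many letters of label \<open>0\<close> as of these letters, each nonempty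
  rest receives a letter of label \<open>0\<close> of its own, which makes it a chain in \<open>v @ r\<close>, as all of \<open>r\<close>
  is to the right of \<open>v\<close>.\<close>

lemma packable_rotate_backward:
  assumes w: "distinct (v @ r)" "set (v @ r) = {1..n}" "1 \<in> set r" and r: "sorted_wrt (<) r"
    and few: "card {t \<in> set v. t \<le> m \<and> cc_label (v @ r) t = 1}
      \<le> card {j \<in> {1..m}. cc_label (v @ r) j = 0}"
    and "packable k (r @ v) m"
  shows "packable (Suc k) (v @ r) m"
proof -
  define a where "a = cc_label (v @ r)"
  define b where "b = cc_label (r @ v)"
  obtain P where P: "\<Union>P = {1..m}" "disjoint P" "\<And>C. C \<in> P \<Longrightarrow> card C \<le> k \<and> chain (r @ v) C"
    using assms(6) by (auto simp: packable_def packing_def)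
  have m: "{1..m} \<subseteq> set (v @ r)" using assms(6) by (auto simp: packable_def)
  have ab: "a j = b j + (if j \<in> set v then 1 else 0)" if "j \<in> {1..m}" for j
    unfolding a_def b_def by (rule cc_label_rotate[OF w]) (use that m w(2) in auto)
  have vr: "j \<in> set v \<or> j \<in> set r" "\<not> (j \<in> set v \<and> j \<in> set r)" if "j \<in> {1..m}" for j
    using that m w(1) by auto
  define Z where "Z = {j \<in> {1..m}. a j = 0}"
  define T where "T = {t \<in> set v. t \<le> m \<and> a t = 1}"
  define Q where "Q = {C \<in> P. C - Z \<noteq> {}}"
  have Zr: "Z \<subseteq> set r" using ab vr by (fastforce simp: Z_def)
  have CU: "i \<in> {1..m}" if "C \<in> P" "i \<in> C" for C i using that P(1) by blast
  have wit: "\<exists>t\<in>C. \<exists>s\<in>C. b t = b i \<and> Suc (b s) = b i \<and> s \<in> set v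
      \<and> (t \<in> set r \<or> t \<in> set v \<and> left_of v t s)" if C: "C \<in> P" and i: "i \<in> C" "0 < b i" for C i
  proof -
    obtain t s where ts: "t \<in> C" "s \<in> C" "b t = b i" "Suc (b s) = b i" "left_of (r @ v) t s"
      using chainE[OF conjunct2[OF P(3)[OF C]] i(1)] i(2) unfolding b_def by blast
    moreover have "s < t" by (rule less_if_cc_label_less[of "r @ v"]) (use ts in \<open>simp add: b_def\<close>)
    ultimately show ?thesis using left_of_across_sorted(2)[OF w(1) r] by blast
  qed
  \<comment> \<open>By \<open>wit\<close>, a letter of label \<open>1\<close> in \<open>r @ v\<close> comes with a letter of \<open>v\<close> that has label \<open>0\<close> there.\<close>
  have "\<exists>t. t \<in> C \<inter> T" if C: "C \<in> Q" for C
  proof -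
    obtain j where j: "j \<in> C" "j \<notin> Z" "C \<in> P" using C by (auto simp: Q_def)
    obtain s where s: "s \<in> C" "b s = 0" "s \<in> set v"
    proof (cases "b j = 0")
      case True
      then have "j \<in> set v" using j ab[OF CU[OF j(3,1)]] CU[OF j(3,1)] by (auto simp: Z_def split: if_splits)
      then show ?thesis using that True j(1) by blast
    next
      case False
      then obtain j' where j': "j' \<in> C" "b j' = 1"
        using chain_has_all_smaller_labels[of "r @ v" C j 1] P(3)[OF j(3)] j(1)
        unfolding b_def by fastforce
      then show ?thesis using wit[OF j(3) j'(1)] that by auto
    qed
    then show ?thesis using ab[OF CU[OF j(3) s(1)]] CU[OF j(3) s(1)] by (auto simp: T_def)
  qed
  then obtain \<tau> where \<tau>: "\<And>C. C \<in> Q \<Longrightarrow> \<tau> C \<in> C \<inter> T" by metis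
  have finZ: "finite Z" by (simp add: Z_def)
  obtain \<kappa> where \<kappa>: "\<kappa> ` T \<subseteq> Z" "inj_on \<kappa> T"
    using card_le_inj[of T Z] few finZ unfolding T_def Z_def a_def by auto
  define f where "f C = \<kappa> (\<tau> C)" for C
  have f: "f C \<in> Z" if "C \<in> Q" for C using \<tau>[OF that] \<kappa>(1) by (auto simp: f_def)
  have inj_f: "C = D" if "C \<in> Q" "D \<in> Q" "f C = f D" for C D
  proof -
    have "\<tau> C = \<tau> D" using that \<tau> \<kappa>(2) by (auto simp: f_def inj_on_def)
    then show ?thesis using \<tau>[OF that(1)] \<tau>[OF that(2)] that P(2) by (auto simp: Q_def disjoint_def)
  qed
  have "chain (v @ r) (insert (f C) (C - Z))" if CQ: "C \<in> Q" for C
    unfolding chain_def a_def[symmetric]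
  proof (intro ballI impI)
    let ?D = "insert (f C) (C - Z)"
    have C: "C \<in> P" using CQ by (simp add: Q_def)
    have keep: "i \<in> ?D" if "i \<in> C" "0 < a i" for i using that by (auto simp: Z_def)
    have fC: "f C \<in> set r" "a (f C) = 0" using f[OF CQ] Zr by (auto simp: Z_def)
    have in_v: "\<exists>t\<in>?D. \<exists>s\<in>?D. a t = a i \<and> Suc (a s) = a i \<and> left_of (v @ r) t s"
      if i: "i \<in> C" "i \<in> set v" for i
    proof -
      have ai: "a i = Suc (b i)" using ab[OF CU[OF C i(1)]] i(2) by auto
      show ?thesis
      proof (cases "b i = 0")
        case True
        then show ?thesis using ai i fC keep[of i] by auto
      next
        case False
        then obtain t s where ts: "t \<in> C" "s \<in> C" "b t = b i" "Suc (b s) = b i" "s \<in> set v"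
          and t: "t \<in> set r \<or> t \<in> set v \<and> left_of v t s"
          using wit[OF C i(1)] by auto
        from t show ?thesis
        proof
          \<comment> \<open>Then \<open>t\<close> itself is one label below \<open>i\<close> in \<open>v @ r\<close>, and it is to the right of \<open>i\<close>.\<close>
          assume t: "t \<in> set r"
          then have "a t = b i" using ab[OF CU[OF C ts(1)]] vr[OF CU[OF C ts(1)]] ts by auto
          then show ?thesis using keep[of i] keep[of t] i ts(1) t ai False by auto
        next
          assume t: "t \<in> set v \<and> left_of v t s"
          then have "a t = a i" "Suc (a s) = a i"
            using ab[OF CU[OF C ts(1)]] ab[OF CU[OF C ts(2)]] ts ai by auto
          then show ?thesis using keep[of t] keep[of s] t ts(1,2) ai False by auto
        qed
      qed
    qed
    fix j assume "j \<in> ?D" "0 < a j"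
    then have j: "j \<in> C" "0 < a j" using fC by auto
    show "\<exists>t\<in>?D. \<exists>s\<in>?D. a t = a j \<and> Suc (a s) = a j \<and> left_of (v @ r) t s"
    proof (cases "j \<in> set v")
      case True
      then show ?thesis using in_v j by blast
    next
      case False
      then have "a j = b j" using ab[OF CU[OF C j(1)]] by auto
      then obtain s where s: "s \<in> C" "Suc (b s) = a j" "s \<in> set v"
        using wit[OF C j(1)] j(2) by auto
      then have "a s = a j" using ab[OF CU[OF C s(1)]] by simp
      then show ?thesis using in_v[OF s(1,3)] by simp
    qed
  qed
  moreover have "card (insert (f C) (C - Z)) \<le> Suc k" if "C \<in> Q" for C
  proof -
    have C: "C \<in> P" using that by (simp add: Q_def)
    then have "finite C" using P(1) by (metis Union_upper finite_atLeastAtMost finite_subset)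
    then have "card (C - Z) \<le> k" using P(3)[OF C] by (meson Diff_subset card_mono le_trans)
    then show ?thesis using \<open>finite C\<close> by (simp add: card_insert_if)
  qed
  moreover have "chain (v @ r) {z}" if "z \<in> Z" for z
    using that by (auto simp: chain_def Z_def a_def)
  moreover have "disjoint ((\<lambda>C. insert (f C) (C - Z)) ` Q \<union> (\<lambda>z. {z}) ` (Z - f ` Q))"
  proof -
    have "insert (f C) (C - Z) \<inter> insert (f D) (D - Z) = {}" if CD: "C \<in> Q" "D \<in> Q" "C \<noteq> D" for C D
    proof -
      have "C \<inter> D = {}" using CD P(2) by (auto simp: Q_def disjoint_def)
      moreover have "f C \<noteq> f D" using inj_f CD by blast
      ultimately show ?thesis using f[OF CD(1)] f[OF CD(2)] by auto
    qed
    then show ?thesis unfolding disjoint_def by auto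
  qed
  moreover have "\<Union>((\<lambda>C. insert (f C) (C - Z)) ` Q \<union> (\<lambda>z. {z}) ` (Z - f ` Q)) = {1..m}"
  proof -
    have "{1..m} - Z \<subseteq> (\<Union>C\<in>Q. C - Z)" using P(1) by (auto simp: Q_def) 
    moreover have "(\<Union>C\<in>Q. C - Z) \<subseteq> {1..m}" using P(1) by (auto simp: Q_def)
    moreover have "f ` Q \<subseteq> Z" "Z \<subseteq> {1..m}" using f by (auto simp: Z_def)
    moreover have "\<Union>((\<lambda>C. insert (f C) (C - Z)) ` Q \<union> (\<lambda>z. {z}) ` (Z - f ` Q))
        = (\<Union>C\<in>Q. C - Z) \<union> f ` Q \<union> (Z - f ` Q)" by auto
    ultimately show ?thesis by auto
  qed
  ultimately have "packing (Suc k) (v @ r) {1..m}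
      ((\<lambda>C. insert (f C) (C - Z)) ` Q \<union> (\<lambda>z. {z}) ` (Z - f ` Q))"
    unfolding packing_def by auto
  then show ?thesis using m unfolding packable_def by auto
qed

lemma tableau_smaller_below:
  assumes "is_tableau T" "t \<in> set (reading_word T)"
  shows "t \<in> set (first_row T) \<or> (\<exists>x<t. left_of (reading_word T) t x)"
  using assms
proof (induction T)
  case (Cons r T)
  show ?case
  proof (cases "t \<in> set r")
    case False
    then have t: "t \<in> set (reading_word T)" using Cons.prems by simp
    from Cons.IH[OF _ t] Cons.prems(1) consider
      i where "i < length (first_row T)" "t = first_row T ! i"
      | x where "x < t" "left_of (reading_word T) t x"
      by (auto simp: in_set_conv_nth)
    then show ?thesis
    proof cases
      case 1
      then have "r ! i < t" "r ! i \<in> set r" using Cons.prems(1) by auto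
      then show ?thesis using t by auto
    qed auto
  qed simp
qed simp

lemma one_in_first_row:
  assumes "is_tableau T" "set (reading_word T) = {1..n}" "1 \<le> n"
  shows "1 \<in> set (first_row T)"
  using tableau_smaller_below[OF assms(1), of 1] assms(2,3) by (auto dest: left_of_in_set)

text \<open>Let \<open>t\<close> have label \<open>1\<close> and lie above the first row. A smaller letter to the right of \<open>t\<close> has label \<open>0\<close>, since
  equal labels increase from left to right, so it is in the first row. This applies to the entry
  below \<open>t\<close>. Hence \<open>t\<close> is in the second row, and the entries below such letters \<open>t\<close> are distinct letters
  of label \<open>0\<close>.\<close>

lemma card_label_one_above_first_row:
  assumes T: "is_tableau (r # R)"
    and w: "distinct (reading_word R @ r)" "set (reading_word R @ r) = {1..n}" "1 \<in> set r"
  shows "card {t \<in> set (reading_word R). t \<le> m \<and> cc_label (reading_word R @ r) t = 1}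
    \<le> card {j \<in> {1..m}. cc_label (reading_word R @ r) j = 0}" (is "card ?T \<le> card ?Z")
proof -
  define q where "q = first_row R"
  define I where "I = {i. i < length q \<and> r ! i \<in> ?Z}"
  let ?w = "reading_word R @ r"
  have q: "length q \<le> length r" "\<And>i. i < length q \<Longrightarrow> r ! i < q ! i"
    using T by (auto simp: q_def)
  have smaller: "cc_label ?w x = 0" if t: "t \<in> ?T" and x: "x < t" "left_of ?w t x" for t x
  proof (rule ccontr)
    assume "cc_label ?w x \<noteq> 0"
    then have eq: "cc_label ?w x = cc_label ?w t"
      using t cc_label_mono[of x t ?w] x(1) by auto
    have "x \<in> {1..n}" using left_of_in_set[OF x(2)] unfolding w(2) by blast
    then have "0 < x" by simp
    then have "left_of ?w x t" using left_of_if_same_label[OF w(1) _ x(1)] eq by simp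
    then show False using left_of_asym[OF w(1)] x(2) by blast
  qed
  have "?T \<subseteq> (\<lambda>i. q ! i) ` I"
  proof
    fix t assume t: "t \<in> ?T"
    have "\<not> (\<exists>x<t. left_of (reading_word R) t x)"
    proof
      assume "\<exists>x<t. left_of (reading_word R) t x"
      then obtain x where x: "x < t" "left_of (reading_word R) t x" by blast
      have xv: "x \<in> set (reading_word R)" using left_of_in_set[OF x(2)] by blast
      moreover from this have "x \<in> {1..n}" unfolding w(2)[symmetric] by simp
      ultimately have "cc_label ?w x \<noteq> 0" using cc_label_rotate[OF w, of x] by simp
      then show False using smaller[OF t x(1)] x(2) by simp
    qed
    then have "t \<in> set q" using tableau_smaller_below[of R t] T t by (auto simp: q_def)
    then obtain i where i: "i < length q" "t = q ! i" by (auto simp: in_set_conv_nth)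
    have ri: "r ! i < t" "r ! i \<in> set r" using q i by auto
    then have "cc_label ?w (r ! i) = 0" using smaller[OF t ri(1)] t by simp
    moreover have "r ! i \<in> {1..n}" using ri(2) unfolding w(2)[symmetric] by simp
    ultimately show "t \<in> (\<lambda>i. q ! i) ` I" using i ri(1) t by (auto simp: I_def)
  qed
  then have "card ?T \<le> card I" using surj_card_le[of I ?T] by (simp add: I_def)
  also have "card I \<le> card ?Z"
    by (rule card_inj_on_le[of "\<lambda>i. r ! i"])
      (use w(1) q(1) in \<open>auto simp: inj_on_def I_def nth_eq_iff_index_eq\<close>)
  finally show ?thesis .
qed

section \<open>Packings and iterated catabolism\<close>

lemma packable_one:
  "packable 1 w m \<longleftrightarrow> {1..m} \<subseteq> set w \<and> (\<forall>j\<in>{1..m}. cc_label w j = 0)"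
proof
  assume pk: "packable 1 w m"
  then obtain P where P: "\<Union>P = {1..m}" "\<And>C. C \<in> P \<Longrightarrow> card C \<le> 1 \<and> chain w C"
    and m: "{1..m} \<subseteq> set w"
    by (auto simp: packable_def packing_def)
  have "cc_label w j = 0" if j: "j \<in> {1..m}" for j
  proof -
    obtain C where C: "C \<in> P" "j \<in> C" using P(1) j by blast
    have "finite C" using C(1) P(1) by (metis Union_upper finite_atLeastAtMost finite_subset)
    then have "C = {j}" using C P(2)[OF C(1)] card_le_Suc0_iff_eq[of C] by auto
    then show ?thesis using P(2)[OF C(1)] by (auto simp: chain_def)
  qed
  then show "{1..m} \<subseteq> set w \<and> (\<forall>j\<in>{1..m}. cc_label w j = 0)" using m by blast
next
  assume "{1..m} \<subseteq> set w \<and> (\<forall>j\<in>{1..m}. cc_label w j = 0)"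
  moreover from this have "packing 1 w {1..m} ((\<lambda>j. {j}) ` {1..m})"
    by (auto simp: packing_def disjoint_def chain_def)
  ultimately show "packable 1 w m" unfolding packable_def by blast
qed

lemma packable_one_tableau:
  assumes r: "sorted_wrt (<) r"
    and w: "distinct (v @ r)" "set (v @ r) = {1..n}" "1 \<in> set r"
  shows "packable 1 (v @ r) m \<longleftrightarrow> {1..m} \<subseteq> set r"
proof
  assume p: "packable 1 (v @ r) m"
  show "{1..m} \<subseteq> set r"
  proof
    fix j assume j: "j \<in> {1..m}"
    then have "cc_label (v @ r) j = cc_label (v @ r) 1" using p packable_one[of "v @ r" m] by auto
    then have "left_of (v @ r) 1 j" if "j \<noteq> 1"
      using left_of_if_same_label[OF w(1), of 1 j] that j by auto
    then show "j \<in> set r" using w(1,3) by (cases "j = 1") (auto dest: left_of_in_set)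
  qed
next
  assume m: "{1..m} \<subseteq> set r"
  have "cc_label (v @ r) j = 0" if "1 \<le> j" "j \<le> m" for j
    using that
  proof (induction j rule: dec_induct)
    case (step j)
    have "{j, Suc j} \<subseteq> set r" using m step by auto
    then have "left_of r j (Suc j)" using left_of_sorted[OF r] by simp
    then show ?case using step by (simp add: cc_label_Suc)
  qed simp
  then show "packable 1 (v @ r) m" using m packable_one[of "v @ r" m] by auto
qed

lemma insertion_tableau_of_permutation:
  assumes w: "distinct w" "set w = {1..n}" "1 \<le> n"
  obtains r R where "insertion_tableau w = r # R" "w \<approx> reading_word R @ r" "is_tableau (r # R)"
    "distinct (reading_word R @ r)" "set (reading_word R @ r) = {1..n}" "1 \<in> set r"
proof -
  have T: "is_tableau (insertion_tableau w)" "w \<approx> reading_word (insertion_tableau w)"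
    using insertion_tableau_knuth[OF w(1)] by auto
  have "insertion_tableau w \<noteq> []" using knuth_equiv_mset[OF T(2)] w(2,3) by auto
  then obtain r R where rR: "insertion_tableau w = r # R" by (cases "insertion_tableau w") auto
  have equiv: "w \<approx> reading_word R @ r" and tab: "is_tableau (r # R)"
    using T rR by auto
  have perm: "distinct (reading_word R @ r)" "set (reading_word R @ r) = {1..n}"
    using mset_eq_imp_distinct_iff[OF knuth_equiv_mset[OF equiv]]
      mset_eq_setD[OF knuth_equiv_mset[OF equiv]] w(1,2) by auto
  have "1 \<in> set r" using one_in_first_row[OF tab, of n] perm(2) w(3) by simp
  with that[OF rR equiv tab perm] show thesis .
qed

text \<open>One catabolism lowers the permitted size of the classes by one, and for classes of size \<open>1\<close> a packing
  says that all letters up to \<open>m\<close> have label \<open>0\<close>.\<close>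

lemma packable_iff_first_row:
  assumes "distinct w" "set w = {1..n}" "1 \<le> n"
  shows "packable (Suc k) w m \<longleftrightarrow>
    {1..m} \<subseteq> set (first_row ((catabolism ^^ k) (insertion_tableau w)))"
  using assms(1,2)
proof (induction k arbitrary: w)
  case (0 w)
  obtain r R where T: "insertion_tableau w = r # R" "w \<approx> reading_word R @ r" "is_tableau (r # R)"
    and perm: "distinct (reading_word R @ r)" "set (reading_word R @ r) = {1..n}" "1 \<in> set r"
    using insertion_tableau_of_permutation[OF 0 assms(3)] .
  have "packable 1 w m \<longleftrightarrow> packable 1 (reading_word R @ r) m"
    by (rule packable_knuth_invariant[OF T(2) 0])
  then show ?case using packable_one_tableau[OF _ perm] T(1,3) by simp
next
  case (Suc k w)
  obtain r R where T: "insertion_tableau w = r # R" "w \<approx> reading_word R @ r" "is_tableau (r # R)"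
    and perm: "distinct (reading_word R @ r)" "set (reading_word R @ r) = {1..n}" "1 \<in> set r"
    using insertion_tableau_of_permutation[OF Suc.prems assms(3)] .
  let ?v = "reading_word R"
  have r: "sorted_wrt (<) r" using T(3) by simp
  have "packable (Suc (Suc k)) w m \<longleftrightarrow> packable (Suc (Suc k)) (?v @ r) m"
    by (rule packable_knuth_invariant[OF T(2) Suc.prems])
  also have "\<dots> \<longleftrightarrow> packable (Suc k) (r @ ?v) m"
    using packable_rotate_forward[OF perm r, of "Suc k" m]
      packable_rotate_backward[OF perm r card_label_one_above_first_row[OF T(3) perm], of "Suc k" m]
    by auto
  also have "\<dots> \<longleftrightarrow> {1..m} \<subseteq> set (first_row ((catabolism ^^ k) (insertion_tableau (r @ ?v))))"
    by (rule Suc.IH) (use perm in auto)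
  also have "insertion_tableau (r @ ?v) = catabolism (insertion_tableau w)"
    by (simp add: catabolism_def T(1))
  finally show ?case by (simp add: funpow_swap1)
qed

lemma le_cat_depth_iff: "m \<le> cat_depth T \<longleftrightarrow> {1..m} \<subseteq> set (first_row T)"
proof -
  let ?Q = "\<lambda>m. {1..m} \<subseteq> set (first_row T)"
  have bound: "y \<le> card (set (first_row T))" if "?Q y" for y
    using card_mono[OF _ that] by simp
  have greatest: "?Q (cat_depth T)"
    unfolding cat_depth_def by (rule GreatestI_nat[of ?Q 0, OF _ bound]) simp_all
  show ?thesis
  proof
    assume "m \<le> cat_depth T"
    then have "{1..m} \<subseteq> {1..cat_depth T}" by simp
    then show "?Q m" using greatest by (rule subset_trans)
  next
    assume "?Q m"
    then show "m \<le> cat_depth T" unfolding cat_depth_def by (rule Greatest_le_nat[of ?Q, OF _ bound])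
  qed
qed

text \<open>The sum telescopes because the depth does not decrease, and that follows from the monotonicity of
  packability in the size of the classes.\<close>

lemma sum_ctype_eq_cat_depth:
  assumes "distinct w" "set w = {1..n}" "1 \<le> n"
  shows "(\<Sum>i<Suc k. ctype w i) = cat_depth ((catabolism ^^ k) (insertion_tableau w))"
proof (induction k)
  case (Suc k)
  let ?d = "\<lambda>k. cat_depth ((catabolism ^^ k) (insertion_tableau w))"
  have packable_iff: "packable (Suc k) w m \<longleftrightarrow> m \<le> ?d k" for k m
    by (simp only: packable_iff_first_row[OF assms] le_cat_depth_iff)
  have "packable (Suc k) w (?d k)" by (simp only: packable_iff)
  then have "packable (Suc (Suc k)) w (?d k)" by (rule packable_mono) simp
  then have "?d k \<le> ?d (Suc k)" by (simp only: packable_iff)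
  moreover have "ctype w (Suc k) = ?d (Suc k) - ?d k"
    unfolding ctype_def ctype_tableau_def by (simp only: nat.case)
  moreover have "(\<Sum>i<Suc (Suc k). ctype w i) = (\<Sum>i<Suc k. ctype w i) + ctype w (Suc k)"
    by (rule sum.lessThan_Suc)
  ultimately show ?case using Suc by linarith
qed (simp add: ctype_def ctype_tableau_def)

text \<open>The case \<open>n = 0\<close> covers the empty word, which has no first row to rotate; for \<open>k = 0\<close> the sum of parts
  is empty.\<close>

lemma packable_degenerate:
  assumes "n = 0 \<or> k = 0" "set w = {1..n}"
  shows "packable k w m \<longleftrightarrow> m = 0"
proof
  assume pk: "packable k w m"
  show "m = 0"
  proof (rule ccontr)
    assume "m \<noteq> 0"
    then have one: "1 \<in> {1..m}" by simp
    moreover have "{1..m} \<subseteq> {1..n}" using pk assms(2) by (simp add: packable_def)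
    ultimately have "n \<noteq> 0" by auto
    obtain P where P: "\<Union>P = {1..m}" "\<And>C. C \<in> P \<Longrightarrow> card C \<le> k"
      using pk by (auto simp: packable_def packing_def)
    obtain C where C: "C \<in> P" "1 \<in> C" using one P(1) by blast
    have "C \<subseteq> {1..m}" using C(1) P(1) by blast
    then have "finite C" by (rule finite_subset) simp
    then have "0 < card C" using C(2) by (auto simp: card_gt_0_iff)
    then show False using P(2)[OF C(1)] assms(1) \<open>n \<noteq> 0\<close> by simp
  qed
next
  assume "m = 0"
  moreover have "packing k w {} {}" by (simp add: packing_def)
  ultimately show "packable k w m" unfolding packable_def by fastforce
qed

text \<open>The sum of the first \<open>k\<close> parts of the catabolizability type is the largest \<open>m\<close> such that the letters up
  to \<open>m\<close> can be partitioned into chains of size at most \<open>k\<close>.\<close>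

lemma le_sum_ctype_iff:
  assumes "distinct w" "set w = {1..n}"
  shows "m \<le> (\<Sum>i<k. ctype w i) \<longleftrightarrow> packable k w m"
proof (cases "n = 0 \<or> k = 0")
  case True
  have Nil: "insertion_tableau [] = []" by (simp add: insertion_tableau_def)
  have funpow: "(catabolism ^^ j) [] = []" for j
    by (induction j) (simp_all add: catabolism_def Nil)
  have depth: "cat_depth [] = 0" using le_cat_depth_iff[of 1 "[]"] by (simp del: One_nat_def)
  have "ctype [] i = 0" for i
    unfolding ctype_def ctype_tableau_def Nil funpow depth by (simp split: nat.split)
  then have "(\<Sum>i<k. ctype w i) = 0" using True assms(2) by auto
  then show ?thesis using packable_degenerate[OF True assms(2)] by simp
next
  case False
  then obtain j where j: "k = Suc j" and n: "1 \<le> n" by (cases k) auto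
  show ?thesis
    unfolding j sum_ctype_eq_cat_depth[OF assms n] packable_iff_first_row[OF assms n]
    by (rule le_cat_depth_iff)
qed

section \<open>Shuffles\<close>

lemma nths_embedding:
  "\<exists>g. strict_mono_on {..<length (nths xs I)} g \<and>
    (\<forall>p<length (nths xs I). g p < length xs \<and> g p \<in> I \<and> xs ! g p = nths xs I ! p)"
proof (induction xs arbitrary: I)
  case (Cons x xs)
  let ?J = "{j. Suc j \<in> I}"
  obtain g where g: "strict_mono_on {..<length (nths xs ?J)} g"
    "\<And>p. p < length (nths xs ?J) \<Longrightarrow> g p < length xs \<and> g p \<in> ?J \<and> xs ! g p = nths xs ?J ! p"
    using Cons by blast
  show ?case
  proof (cases "0 \<in> I")
    case True
    define h where "h p = (case p of 0 \<Rightarrow> 0 | Suc p \<Rightarrow> Suc (g p))" for p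
    have "strict_mono_on {..<length (nths (x # xs) I)} h"
      using g(1) True
      by (auto simp: strict_mono_on_def nths_Cons h_def split: nat.splits)
    moreover have "\<forall>p<length (nths (x # xs) I).
        h p < length (x # xs) \<and> h p \<in> I \<and> (x # xs) ! h p = nths (x # xs) I ! p"
      using g(2) True by (auto simp: nths_Cons h_def split: nat.splits)
    ultimately show ?thesis by blast
  next
    case False
    then show ?thesis
      using g by (intro exI[of _ "\<lambda>p. Suc (g p)"]) (auto simp: strict_mono_on_def nths_Cons)
  qed
qed (simp add: strict_mono_on_def)

lemma left_of_nth_iff:
  assumes "distinct w" "p < length w" "q < length w"
  shows "left_of w (w ! p) (w ! q) \<longleftrightarrow> p < q"
  using assms by (auto simp: left_of_def nth_eq_iff_index_eq)

text \<open>The letters of a component \<open>u\<close> are found in \<open>w\<close> at the positions of the component; the map keeps labels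
  and relative order, which is all that the definition of a chain refers to.\<close>

lemma letter_embedding:
  assumes u: "distinct u" and w: "distinct w" and cc: "nths (cc w) I = cc u"
  shows "\<exists>\<phi>. inj_on \<phi> (set u) \<and> \<phi> ` set u \<subseteq> {w ! p |p. p < length w \<and> p \<in> I} \<and>
    (\<forall>a\<in>set u. cc_label w (\<phi> a) = cc_label u a) \<and>
    (\<forall>a\<in>set u. \<forall>b\<in>set u. left_of u a b \<longrightarrow> left_of w (\<phi> a) (\<phi> b))"
proof -
  have len: "length (cc u) = length u" "length (cc w) = length w" by (simp_all add: cc_def)
  obtain g where g: "strict_mono_on {..<length u} g"
    "\<And>p. p < length u \<Longrightarrow> g p < length w \<and> g p \<in> I \<and> cc w ! g p = cc u ! p"
    using nths_embedding[of "cc w" I] unfolding cc len by blast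
  define pos where "pos = inv_into {..<length u} ((!) u)"
  have pos: "pos a < length u" "u ! pos a = a" if "a \<in> set u" for a
  proof -
    have a: "a \<in> (!) u ` {..<length u}" using that by (auto simp: in_set_conv_nth)
    show "pos a < length u" using inv_into_into[OF a] by (simp add: pos_def)
    show "u ! pos a = a" using f_inv_into_f[OF a] by (simp add: pos_def)
  qed
  define \<phi> where "\<phi> a = w ! g (pos a)" for a
  have left: "left_of w (\<phi> a) (\<phi> b)" if ab: "a \<in> set u" "b \<in> set u" "left_of u a b" for a b
  proof -
    have "pos a < pos b" using left_of_nth_iff[OF u, of "pos a" "pos b"] pos ab by simp
    then have "g (pos a) < g (pos b)" using g(1) pos ab by (auto simp: strict_mono_on_def)
    then show ?thesis unfolding \<phi>_def using left_of_nth_iff[OF w] g(2) pos ab by simp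
  qed
  have "inj_on \<phi> (set u)"
  proof (rule inj_onI, rule ccontr)
    fix a b assume ab: "a \<in> set u" "b \<in> set u" "\<phi> a = \<phi> b" "a \<noteq> b"
    then have "left_of w (\<phi> a) (\<phi> a)" using left_of_total[OF ab(1,2,4)] left by metis
    then show False using left_of_asym[OF w] by blast
  qed
  moreover have "cc_label w (\<phi> a) = cc_label u a" if "a \<in> set u" for a
    using g(2)[OF pos(1)[OF that]] pos[OF that] by (auto simp: cc_def \<phi>_def)
  moreover have "\<phi> ` set u \<subseteq> {w ! p |p. p < length w \<and> p \<in> I}"
    using g(2)[OF pos(1)] by (auto simp: \<phi>_def)
  ultimately show ?thesis using left by (intro exI[of _ \<phi>]) simp
qed

lemma packing_image:
  assumes P: "packing k u U P" and U: "U \<subseteq> set u"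
    and \<phi>: "inj_on \<phi> (set u)" "\<And>a. a \<in> set u \<Longrightarrow> cc_label w (\<phi> a) = cc_label u a"
      "\<And>a b. left_of u a b \<Longrightarrow> left_of w (\<phi> a) (\<phi> b)"
  shows "packing k w (\<phi> ` U) ((`) \<phi> ` P)"
  unfolding packing_def
proof (intro conjI ballI)
  have inj: "inj_on \<phi> (\<Union>P)" using P U inj_on_subset[OF \<phi>(1)] by (auto simp: packing_def)
  show "\<Union> ((`) \<phi> ` P) = \<phi> ` U" using P by (auto simp: packing_def)
  show "disjoint ((`) \<phi> ` P)"
    by (rule disjoint_image[OF inj]) (use P in \<open>simp add: packing_def\<close>)
  fix D assume "D \<in> (`) \<phi> ` P"
  then obtain C where C: "C \<in> P" "D = \<phi> ` C" by blast
  have "inj_on \<phi> C" using inj C(1) by (meson Union_upper inj_on_subset)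
  then show "card D \<le> k" using P C by (simp add: packing_def card_image)
  have CU: "C \<subseteq> set u" using P U C(1) by (auto simp: packing_def)
  have chain: "chain u C" using P C(1) by (simp add: packing_def)
  show "chain w D"
    unfolding chain_def
  proof (intro ballI impI)
    fix j assume "j \<in> D" "0 < cc_label w j"
    then obtain i where i: "i \<in> C" "j = \<phi> i" "0 < cc_label u i" using C(2) \<phi>(2) CU by auto
    obtain t s where ts: "t \<in> C" "s \<in> C" "cc_label u t = cc_label u i"
      "Suc (cc_label u s) = cc_label u i" "left_of u t s"
      using chainE[OF chain i(1,3)] .
    have "cc_label w (\<phi> x) = cc_label u x" if "x \<in> C" for x using \<phi>(2) CU that by blast
    then show "\<exists>t\<in>D. \<exists>s\<in>D. cc_label w t = cc_label w j
        \<and> Suc (cc_label w s) = cc_label w j \<and> left_of w t s"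
      using ts i \<phi>(3)[OF ts(5)] unfolding C(2) i(2) by (intro bexI[of _ "\<phi> t"] bexI[of _ "\<phi> s"]) auto
  qed
qed

lemma packing_Union:
  assumes "\<And>j. j \<in> J \<Longrightarrow> packing k w (U j) (P j)" "disjoint_family_on U J"
  shows "packing k w (\<Union>j\<in>J. U j) (\<Union>j\<in>J. P j)"
  unfolding packing_def
proof (intro conjI ballI)
  have "\<Union> (\<Union>j\<in>J. P j) = (\<Union>j\<in>J. \<Union> (P j))" by blast
  also have "\<dots> = (\<Union>j\<in>J. U j)" using assms(1) by (simp add: packing_def)
  finally show "\<Union> (\<Union>j\<in>J. P j) = (\<Union>j\<in>J. U j)" .
  show "disjoint (\<Union>j\<in>J. P j)"
    unfolding disjoint_def
  proof (intro ballI impI)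
    fix C D assume "C \<in> (\<Union>j\<in>J. P j)" "D \<in> (\<Union>j\<in>J. P j)" "C \<noteq> D"
    then obtain i j where ij: "i \<in> J" "C \<in> P i" "j \<in> J" "D \<in> P j" by blast
    show "C \<inter> D = {}"
    proof (cases "i = j")
      case True
      have "disjoint (P i)" using assms(1)[OF ij(1)] by (simp add: packing_def)
      then show ?thesis using ij True \<open>C \<noteq> D\<close> by (auto simp: disjoint_def)
    next
      case False
      have "C \<subseteq> U i" "D \<subseteq> U j" using assms(1)[OF ij(1)] assms(1)[OF ij(3)] ij by (auto simp: packing_def)
      moreover have "U i \<inter> U j = {}" using assms(2) ij False by (simp add: disjoint_family_on_def)
      ultimately show ?thesis by blast
    qed
  qed
qed (use assms(1) in \<open>auto simp: packing_def\<close>)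

text \<open>The images of the packings of the components are disjoint and together pack some set of letters
  of \<open>w\<close>, in general not an initial segment, so the exchange lemma is needed.\<close>

lemma packable_shuffle:
  assumes w: "distinct w" "set w = {1..n}" and us: "\<And>u. u \<in> set us \<Longrightarrow> distinct u"
    and shuffle: "is_shuffle (cc w) (map cc us)"
    and packable: "\<And>j. j < length us \<Longrightarrow> packable k (us ! j) (f j)"
  shows "packable k w (\<Sum>j<length us. f j)"
proof -
  obtain c where c: "\<And>j. j < length us \<Longrightarrow> nths (cc w) {p. c p = j} = cc (us ! j)"
    using shuffle by (auto simp: is_shuffle_def)
  let ?J = "{..<length us}"
  define embeds where "embeds j \<phi> \<longleftrightarrow> inj_on \<phi> (set (us ! j)) \<and>
    \<phi> ` set (us ! j) \<subseteq> {w ! p |p. p < length w \<and> p \<in> {p. c p = j}} \<and>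
    (\<forall>a\<in>set (us ! j). cc_label w (\<phi> a) = cc_label (us ! j) a) \<and>
    (\<forall>a\<in>set (us ! j). \<forall>b\<in>set (us ! j). left_of (us ! j) a b \<longrightarrow> left_of w (\<phi> a) (\<phi> b))" for j \<phi>
  have "\<exists>\<phi>. embeds j \<phi>" if "j \<in> ?J" for j
    unfolding embeds_def by (rule letter_embedding[OF _ w(1) c]) (use that us in auto)
  then obtain \<phi> where "\<forall>j\<in>?J. embeds j (\<phi> j)" using bchoice[of ?J embeds] by blast
  then have inj: "\<And>j. j \<in> ?J \<Longrightarrow> inj_on (\<phi> j) (set (us ! j))"
    and range: "\<And>j. j \<in> ?J \<Longrightarrow> \<phi> j ` set (us ! j) \<subseteq> {w ! p |p. p < length w \<and> p \<in> {p. c p = j}}"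
    and lab: "\<And>j a. j \<in> ?J \<Longrightarrow> a \<in> set (us ! j) \<Longrightarrow> cc_label w (\<phi> j a) = cc_label (us ! j) a"
    and left: "\<And>j a b. j \<in> ?J \<Longrightarrow> a \<in> set (us ! j) \<Longrightarrow> b \<in> set (us ! j) \<Longrightarrow>
      left_of (us ! j) a b \<Longrightarrow> left_of w (\<phi> j a) (\<phi> j b)"
    by (simp_all add: embeds_def)
  have sub: "{1..f j} \<subseteq> set (us ! j)" if "j \<in> ?J" for j
    using packable that by (auto simp: packable_def)
  have "\<forall>j\<in>?J. \<exists>P. packing k (us ! j) {1..f j} P" using packable by (simp add: packable_def)
  from bchoice[OF this]
  obtain P where P: "\<And>j. j \<in> ?J \<Longrightarrow> packing k (us ! j) {1..f j} (P j)" by blast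
  define U where "U j = \<phi> j ` {1..f j}" for j
  have U: "U j \<subseteq> {w ! p |p. p < length w \<and> c p = j}" if "j \<in> ?J" for j
    using range[OF that] image_mono[OF sub[OF that], of "\<phi> j"] unfolding U_def by auto
  have disj: "disjoint_family_on U ?J"
    unfolding disjoint_family_on_def
  proof (intro ballI impI)
    fix i j assume ij: "i \<in> ?J" "j \<in> ?J" "i \<noteq> j"
    show "U i \<inter> U j = {}"
    proof (rule ccontr)
      assume "U i \<inter> U j \<noteq> {}"
      then obtain x where "x \<in> U i" "x \<in> U j" by blast
      then obtain p q where "p < length w" "c p = i" "x = w ! p" "q < length w" "c q = j" "x = w ! q"
        using U[OF ij(1)] U[OF ij(2)] by blast
      then show False using w(1) ij(3) by (auto simp: nth_eq_iff_index_eq)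
    qed
  qed
  have "packing k w (\<Union>j\<in>?J. U j) (\<Union>j\<in>?J. (`) (\<phi> j) ` P j)"
  proof (rule packing_Union[OF _ disj])
    fix j assume j: "j \<in> ?J"
    show "packing k w (U j) ((`) (\<phi> j) ` P j)"
      unfolding U_def
      by (rule packing_image[OF P[OF j] sub[OF j] inj[OF j] lab[OF j] left[OF j]])
        (use left_of_in_set in blast)+
  qed
  moreover have "(\<Union>j\<in>?J. U j) \<subseteq> {1..n}"
    unfolding w(2)[symmetric] using U by fastforce
  ultimately have "packable k w (card (\<Union>j\<in>?J. U j))" by (rule packing_exchange[OF w])
  moreover have "card (\<Union>j\<in>?J. U j) = (\<Sum>j\<in>?J. card (U j))"
    by (rule card_UN_disjoint) (use disj in \<open>auto simp: U_def disjoint_family_on_def\<close>)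
  moreover have "card (U j) = f j" if "j \<in> ?J" for j
    unfolding U_def using card_image[OF inj_on_subset[OF inj[OF that] sub[OF that]]] by simp
  ultimately show ?thesis by simp
qed

theorem theoremB:
  fixes us :: "nat list list" and w :: "nat list"
  assumes "\<forall>u\<in>set us. is_perm u"
    and "is_perm w"
    and "is_shuffle (cc w) (map cc us)"
  shows "ctype w \<unrhd> (\<lambda>i. \<Sum>j<length us. ctype (us ! j) i)"
  unfolding dominates_def
proof
  fix k
  have perm: "distinct u \<and> set u = {1..length u}" if "is_perm u" for u
    using permutations_of_setD[OF that] by simp
  have w: "distinct w" "set w = {1..length w}" using perm[OF assms(2)] by blast+
  have pack: "packable k (us ! j) (\<Sum>i<k. ctype (us ! j) i)" if "j < length us" for j
  proof -
    have "is_perm (us ! j)" using assms(1) nth_mem[OF that] by blast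
    then show ?thesis
      using iffD1[OF le_sum_ctype_iff order_refl] perm[of "us ! j"] by blast
  qed
  have "packable k w (\<Sum>j<length us. \<Sum>i<k. ctype (us ! j) i)"
    by (rule packable_shuffle[OF w _ assms(3) pack]) (use perm assms(1) in blast)
  then have "(\<Sum>j<length us. \<Sum>i<k. ctype (us ! j) i) \<le> (\<Sum>i<k. ctype w i)"
    by (simp only: le_sum_ctype_iff[OF w])
  moreover have "(\<Sum>i<k. \<Sum>j<length us. ctype (us ! j) i) = (\<Sum>j<length us. \<Sum>i<k. ctype (us ! j) i)"
    by (rule sum.swap)
  ultimately show "(\<Sum>i<k. \<Sum>j<length us. ctype (us ! j) i) \<le> (\<Sum>i<k. ctype w i)" by simp
qed

end
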